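(* Let $n \ge 2$ and $m \ge 1$ be integers, let $S_1, \ldots, S_m \subseteq \mathbb{Z}^n$ be M$^\natural$-convex sets, and let $W = S_1 + \cdots + S_m$. Then for every $x \in \overline{W}$ there exists $z \in W$ with $\|x - z\|_\infty \le 1 - 1/n$.
   Context: For $S \subseteq \mathbb{R}^n$, $\overline{S}$ denotes the convex hull of $S$; the Minkowski sum is $S_1 + \cdots + S_m = \{x^1 + \cdots + x^m \mid x^i \in S_i\}$. Let $e^i$ denote the $i$-th unit vector. A nonempty set $S \subseteq \mathbb{Z}^n$ is M$^\natural$-convex if for any $x, y \in S$ and any $i$ with $x_i > y_i$, either (i) $x - e^i \in S$ and $y + e^i \in S$, or (ii) there exists $j$ with $x_j < y_j$ such that $x - e^i + e^j \in S$ and $y + e^i - e^j \in S$. *)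

theory Defs
  imports "HOL-Analysis.Analysis" "HOL-Library.Set_Algebras"
begin

text \<open>Integer vectors are represented as the real vectors with integral components, so that
  Minkowski sums and convex hulls of sets of integer vectors are formed in one and the same space.
  The unit vector \<open>e\<^sup>i\<close> is \<open>axis i 1\<close>.\<close>

definition Mnat_convex :: "(real ^ 'n) set \<Rightarrow> bool" where
  "Mnat_convex S \<longleftrightarrow>
     S \<noteq> {} \<and>
     (\<forall>x\<in>S. \<forall>i. x $ i \<in> \<int>) \<and>
     (\<forall>x\<in>S. \<forall>y\<in>S. \<forall>i. x $ i > y $ i \<longrightarrow>
        (x - axis i 1 \<in> S \<and> y + axis i 1 \<in> S) \<or>
        (\<exists>j. x $ j < y $ j \<and>
             x - axis i 1 + axis j 1 \<in> S \<and> y + axis i 1 - axis j 1 \<in> S))"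

end

theory Submission
  imports Defs
begin

text \<open>An additional coordinate holding the negative of the component sum makes M-natural-convex
  sets satisfy an exchange property between two coordinates. Its one-sided form passes to
  Minkowski sums and implies the simultaneous one. Hence \<open>x\<close> is a convex combination of points of
  \<open>W\<close> any two of which differ by at most 1 in each coordinate. Drawing a point with these weights,
  a given coordinate is off by more than \<open>1 - 1/n\<close> with probability less than \<open>1/n\<close>, so with
  positive probability no coordinate is.\<close>

section \<open>One-sided exchange and Minkowski sums\<close>

text \<open>The l1 distance, with natural values so that it can measure the progress of the
  inductions below.\<close>

definition dist1 :: "int ^ 'm \<Rightarrow> int ^ 'm \<Rightarrow> nat" where
  "dist1 x y = (\<Sum>k\<in>UNIV. nat \<bar>x $ k - y $ k\<bar>)"

lemma dist1_less:
  assumes "\<And>k. \<bar>x' $ k - y' $ k\<bar> \<le> \<bar>x $ k - y $ k\<bar>"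
    and "\<bar>x' $ i - y' $ i\<bar> < \<bar>x $ i - y $ i\<bar>"
  shows "dist1 x' y' < dist1 x y"
  unfolding dist1_def
proof (rule sum_strict_mono_ex1)
  show "\<exists>k\<in>UNIV. nat \<bar>x' $ k - y' $ k\<bar> < nat \<bar>x $ k - y $ k\<bar>"
    using assms(2) by (intro bexI[of _ i]) auto
qed (use assms(1) in \<open>auto intro: nat_mono\<close>)

text \<open>The exchange axiom of M-convex sets restricted to its effect on \<open>x\<close>. The
  effect on \<open>y\<close> is captured by the same property of the set of negatives.\<close>

definition one_sided_exchange :: "(int ^ 'm) set \<Rightarrow> bool" where
  "one_sided_exchange T \<longleftrightarrow> (\<forall>x\<in>T. \<forall>y\<in>T. \<forall>i. y $ i < x $ i \<longrightarrow>
     (\<exists>j. x $ j < y $ j \<and> x - axis i 1 + axis j 1 \<in> T))"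

lemma one_sided_exchangeD:
  assumes "one_sided_exchange T" "x \<in> T" "y \<in> T" "y $ i < x $ i"
  obtains j where "x $ j < y $ j" "x - axis i 1 + axis j 1 \<in> T"
  using assms unfolding one_sided_exchange_def by blast

lemma mem_uminus_image: "x \<in> uminus ` T \<longleftrightarrow> - x \<in> T" for x :: "'a::group_add"
  by (metis (no_types, lifting) image_iff minus_minus)

lemma one_sided_exchange_uminusD:
  assumes "one_sided_exchange (uminus ` T)" "x \<in> T" "y \<in> T" "y $ i < x $ i"
  obtains j where "x $ j < y $ j" "y + axis i 1 - axis j 1 \<in> T"
proof -
  obtain j where "(- y) $ j < (- x) $ j" "- y - axis i 1 + axis j 1 \<in> uminus ` T"
    using assms by (elim one_sided_exchangeD[where x = "- y" and y = "- x" and i = i])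
      (auto simp: mem_uminus_image)
  then show thesis
    by (intro that[of j]) (auto simp: mem_uminus_image algebra_simps)
qed

lemma one_sided_exchange_zero: "one_sided_exchange {0}"
  by (auto simp: one_sided_exchange_def)

text \<open>Exchanges are chained: whenever the coordinate \<open>q\<close> that was just raised is not below
  \<open>b1 + b2\<close>, one of the summands exceeds its target there and can be exchanged again, which
  brings it closer to its target.\<close>

lemma one_sided_exchange_chain:
  assumes A: "one_sided_exchange A" and B: "one_sided_exchange B"
    and b: "b1 \<in> A" "b2 \<in> B" and i: "(b1 + b2) $ i < x $ i"
    and "a1 \<in> A" "a2 \<in> B" "a1 + a2 = x - axis i 1 + axis q 1"
  shows "\<exists>j. x $ j < (b1 + b2) $ j \<and> x - axis i 1 + axis j 1 \<in> A + B"
  using assms(6-8)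
proof (induction "dist1 a1 b1 + dist1 a2 b2" arbitrary: a1 a2 q rule: less_induct)
  case less
  show ?case
  proof (cases "x $ q < (b1 + b2) $ q")
    case True
    moreover have "x - axis i 1 + axis q 1 \<in> A + B"
      using less.prems by (metis set_plus_intro)
    ultimately show ?thesis by blast
  next
    case False
    \<comment> \<open>For \<open>q = i\<close> the two unit vectors cancel and this is the
      hypothesis on \<open>i\<close>; otherwise the left side is \<open>x $ q + 1\<close>.\<close>
    have "(a1 + a2) $ q > (b1 + b2) $ q"
      unfolding less.prems(3) using False i by (auto simp: axis_def)
    then consider "b1 $ q < a1 $ q" | "b2 $ q < a2 $ q"
      by fastforce
    then show ?thesis
    proof cases
      case 1
      then obtain j where j: "a1 $ j < b1 $ j" "a1 - axis q 1 + axis j 1 \<in> A"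
        using one_sided_exchangeD[OF A less.prems(1) b(1)] by blast
      have "dist1 (a1 - axis q 1 + axis j 1) b1 < dist1 a1 b1"
        using 1 j by (intro dist1_less[where i = q]) (auto simp: axis_def)
      moreover have "a1 - axis q 1 + axis j 1 + a2 = x - axis i 1 + axis j 1"
        using less.prems(3) by (simp add: algebra_simps)
      ultimately show ?thesis
        using less.hyps j(2) less.prems(2) by (metis add_less_cancel_right)
    next
      case 2
      then obtain j where j: "a2 $ j < b2 $ j" "a2 - axis q 1 + axis j 1 \<in> B"
        using one_sided_exchangeD[OF B less.prems(2) b(2)] by blast
      have "dist1 (a2 - axis q 1 + axis j 1) b2 < dist1 a2 b2"
        using 2 j by (intro dist1_less[where i = q]) (auto simp: axis_def)
      moreover have "a1 + (a2 - axis q 1 + axis j 1) = x - axis i 1 + axis j 1"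
        using less.prems(3) by (simp add: algebra_simps)
      ultimately show ?thesis
        using less.hyps j(2) less.prems(1) by (metis add_less_cancel_left)
    qed
  qed
qed

lemma one_sided_exchange_plus:
  assumes "one_sided_exchange A" "one_sided_exchange B"
  shows "one_sided_exchange (A + B)"
  unfolding one_sided_exchange_def
proof (intro ballI allI impI)
  fix x y i assume "x \<in> A + B" "y \<in> A + B" and i: "y $ i < x $ i"
  then obtain a1 a2 b1 b2 where "a1 \<in> A" "a2 \<in> B" "b1 \<in> A" "b2 \<in> B"
    and "x = a1 + a2" "y = b1 + b2"
    by (auto elim!: set_plus_elim)
  \<comment> \<open>The chain starts at \<open>q = i\<close>, a void exchange.\<close>
  moreover from this have "a1 + a2 = x - axis i 1 + axis i 1" by simp
  ultimately show "\<exists>j. x $ j < y $ j \<and> x - axis i 1 + axis j 1 \<in> A + B"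
    using one_sided_exchange_chain[OF assms] i by blast
qed

lemma one_sided_exchange_sum:
  assumes "finite K" "\<And>k. k \<in> K \<Longrightarrow> one_sided_exchange (A k)"
  shows "one_sided_exchange (\<Sum>k\<in>K. A k)"
  using assms
  by (induction K) (auto simp: set_zero one_sided_exchange_zero intro!: one_sided_exchange_plus)

text \<open>Serves negation, so that the negative of a sum is a sum of negatives, and the projection
  that drops the additional coordinate.\<close>

lemma additive_image_sum_sets:
  fixes f :: "'a::comm_monoid_add \<Rightarrow> 'b::comm_monoid_add" and A :: "'k \<Rightarrow> 'a set"
  assumes "finite K" "f 0 = 0" "\<And>a b. f (a + b) = f a + f b"
  shows "f ` (\<Sum>k\<in>K. A k) = (\<Sum>k\<in>K. f ` A k)"
  using assms(1)
proof (induction K)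
  case (insert k K)
  have "f ` (A k + B) = f ` A k + f ` B" for B
    by (force simp: set_plus_def assms(3))
  with insert show ?case by simp
qed (simp add: set_zero assms)

section \<open>From one-sided to simultaneous exchange\<close>

definition exchangeable :: "(int ^ 'm) set \<Rightarrow> int ^ 'm \<Rightarrow> int ^ 'm \<Rightarrow> 'm \<Rightarrow> bool" where
  "exchangeable T x y i \<longleftrightarrow>
     (\<exists>j. x $ j < y $ j \<and> x - axis i 1 + axis j 1 \<in> T \<and> y + axis i 1 - axis j 1 \<in> T)"

text \<open>Negation swaps the roles of the two points, so each statement about \<open>x\<close> has
  a dual about \<open>y\<close>.\<close>

lemma exchangeable_uminus:
  "exchangeable (uminus ` T) x y i \<longleftrightarrow> exchangeable T (- y) (- x) i"
  by (auto simp: exchangeable_def mem_uminus_image algebra_simps)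

lemma dist1_uminus: "dist1 (- x) (- y) = dist1 y x"
  by (simp add: dist1_def algebra_simps)

text \<open>An exchange of \<open>y\<close> at \<open>q\<close> against
  \<open>x - axis i 1 + axis p 1\<close> yields \<open>y'\<close> closer to \<open>x\<close>, and
  the induction hypothesis exchanges \<open>x\<close> and \<open>y'\<close> at \<open>i\<close>
  through some \<open>q'\<close>. The new second point is below \<open>y\<close> at most in
  \<open>q\<close> and \<open>q'\<close>, so raising \<open>y\<close> at \<open>i\<close> towards it
  lowers \<open>y\<close> at one of these; lowering at \<open>q'\<close> completes an exchange of
  \<open>x\<close> and \<open>y\<close>.\<close>

lemma exchangeable_step:
  assumes T: "one_sided_exchange T" "one_sided_exchange (uminus ` T)"
    and IH: "\<And>x' y'. dist1 x' y' < dist1 x y \<Longrightarrow> x' \<in> T \<Longrightarrow> y' \<in> T \<Longrightarrow> y' $ i < x' $ i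
               \<Longrightarrow> exchangeable T x' y' i"
    and xy: "x \<in> T" "y \<in> T" "y $ i < x $ i"
    and p: "x $ p < y $ p" "x - axis i 1 + axis p 1 \<in> T"
    and q: "(x - axis i 1 + axis p 1) $ q < y $ q"
  shows "exchangeable T x y i \<or> y + axis i 1 - axis q 1 \<in> T"
proof -
  have ip: "i \<noteq> p" using xy p by auto
  have qi: "q \<noteq> i" using xy q p by (auto simp: axis_def split: if_splits)
  obtain k where k: "y $ k < (x - axis i 1 + axis p 1) $ k" "y - axis q 1 + axis k 1 \<in> T"
    using one_sided_exchangeD[OF T(1) xy(2) p(2) q] by blast
  \<comment> \<open>At \<open>p\<close> the raised point has value \<open>x $ p + 1\<close>, which
    is still at most \<open>y $ p\<close>.\<close>
  have kp: "k \<noteq> p" using k p ip by (auto simp: axis_def)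
  define y' where "y' = y - axis q 1 + axis k 1"
  have y'T: "y' \<in> T" using k y'_def by simp
  have y'i: "y' $ i < x $ i"
    using k(1) xy(3) qi ip by (auto simp: y'_def axis_def split: if_splits)
  have "dist1 x y' < dist1 x y"
    using k(1) q kp qi ip by (intro dist1_less[where i = q]) (auto simp: y'_def axis_def split: if_splits)
  from IH[OF this xy(1) y'T y'i] obtain q' where q': "x $ q' < y' $ q'"
    "x - axis i 1 + axis q' 1 \<in> T" "y' + axis i 1 - axis q' 1 \<in> T"
    unfolding exchangeable_def by blast
  have q'i: "q' \<noteq> i" using q' y'i by auto
  have q'y: "x $ q' < y $ q'"
    using q'(1) k(1) kp by (auto simp: y'_def axis_def split: if_splits)
  have "y $ i < (y' + axis i 1 - axis q' 1) $ i"
    using qi q'i by (auto simp: y'_def axis_def)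
  then obtain t where t: "(y' + axis i 1 - axis q' 1) $ t < y $ t" "y + axis i 1 - axis t 1 \<in> T"
    using one_sided_exchange_uminusD[OF T(2) q'(3) xy(2)] by blast
  have "t = q \<or> t = q'"
    using t(1) by (auto simp: y'_def axis_def split: if_splits)
  then show ?thesis
    using t(2) q'(2) q'y unfolding exchangeable_def by blast
qed

text \<open>If the exchange fails for \<open>x\<close> and \<open>y\<close>, the step lemma and its dual leave just
  two coordinates \<open>p\<close> and \<open>r\<close> in which \<open>x\<close> is below \<open>y\<close>, each by one.\<close>

lemma one_sided_imp_exchangeable:
  assumes T: "one_sided_exchange T" "one_sided_exchange (uminus ` T)"
    and "x \<in> T" "y \<in> T" "y $ i < x $ i"
  shows "exchangeable T x y i"
  using assms(3-5)
proof (induction "dist1 x y" arbitrary: x y rule: less_induct)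
  case less
  note xy = less.prems
  show ?case
  proof (rule ccontr)
    assume fail: "\<not> exchangeable T x y i"
    obtain p where p: "x $ p < y $ p" "x - axis i 1 + axis p 1 \<in> T"
      using one_sided_exchangeD[OF T(1) xy] by blast
    obtain r where r: "x $ r < y $ r" "y + axis i 1 - axis r 1 \<in> T"
      using one_sided_exchange_uminusD[OF T(2) xy] by blast
    have pR: "y + axis i 1 - axis p 1 \<notin> T" and rP: "x - axis i 1 + axis r 1 \<notin> T"
      using fail p r unfolding exchangeable_def by blast+
    have ne: "p \<noteq> i" "r \<noteq> i" "p \<noteq> r" using p r xy pR by auto
    have 1: "y + axis i 1 - axis q 1 \<in> T" if "(x - axis i 1 + axis p 1) $ q < y $ q" for q
      using exchangeable_step[OF T less.hyps xy p that] fail by blast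
    \<comment> \<open>The dual of the preceding fact: the step lemma for the negated set, with
      \<open>r\<close> in place of \<open>p\<close>.\<close>
    have 2: "x - axis i 1 + axis q 1 \<in> T" if q: "x $ q < (y + axis i 1 - axis r 1) $ q" for q
    proof -
      have uu: "uminus ` uminus ` T = T" by (simp add: image_comp)
      have "exchangeable (uminus ` T) (- y) (- x) i \<or> - x + axis i 1 - axis q 1 \<in> uminus ` T"
      proof (rule exchangeable_step[where p = r])
        fix x' y' assume h: "dist1 x' y' < dist1 (- y) (- x)" "x' \<in> uminus ` T" "y' \<in> uminus ` T"
          "y' $ i < x' $ i"
        have "dist1 (- y') (- x') < dist1 x y"
          using h(1) by (simp add: dist1_uminus)
        then have "exchangeable T (- y') (- x') i"
          by (rule less.hyps) (use h in \<open>auto simp: mem_uminus_image\<close>)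
        then show "exchangeable (uminus ` T) x' y' i"
          by (simp add: exchangeable_uminus)
      qed (use T uu xy r q in \<open>auto simp: mem_uminus_image algebra_simps\<close>)
      then show ?thesis
        using fail by (simp add: exchangeable_uminus mem_uminus_image algebra_simps)
    qed
    have yp: "y $ p = x $ p + 1"
    proof (rule ccontr)
      assume "y $ p \<noteq> x $ p + 1"
      then have "(x - axis i 1 + axis p 1) $ p < y $ p"
        using p ne by (auto simp: axis_def)
      with 1 pR show False by blast
    qed
    have yr: "y $ r = x $ r + 1"
    proof (rule ccontr)
      assume "y $ r \<noteq> x $ r + 1"
      then have "x $ r < (y + axis i 1 - axis r 1) $ r"
        using r ne by (auto simp: axis_def)
      with 2 rP show False by blast
    qed
    have only: "q = p \<or> q = r" if q: "x $ q < y $ q" for q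
    proof (rule ccontr)
      assume "\<not> (q = p \<or> q = r)"
      then have "(x - axis i 1 + axis p 1) $ q < y $ q" "x $ q < (y + axis i 1 - axis r 1) $ q"
        using q xy by (auto simp: axis_def)
      from 1[OF this(1)] 2[OF this(2)] q fail show False
        unfolding exchangeable_def by blast
    qed
    \<comment> \<open>Raising \<open>x\<close> at \<open>r\<close> closes the gap there, so
      \<open>p\<close> is the only coordinate in which the new point can be below \<open>y\<close>.
      Raising \<open>y\<close> at \<open>i\<close> towards this point then has to lower
      \<open>y\<close> at \<open>p\<close>.\<close>
    obtain k where k: "y $ k < x $ k" "x + axis r 1 - axis k 1 \<in> T"
      using one_sided_exchange_uminusD[OF T(2) xy(2) xy(1) r(1)] by blast
    have ki: "k \<noteq> i" using k rP by (auto simp: algebra_simps)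
    have "y $ i < (x + axis r 1 - axis k 1) $ i"
      using xy ki ne by (auto simp: axis_def)
    then obtain t where t: "(x + axis r 1 - axis k 1) $ t < y $ t" "y + axis i 1 - axis t 1 \<in> T"
      using one_sided_exchange_uminusD[OF T(2) k(2) xy(2)] by blast
    have "t = p"
      using t(1) only[of t] k(1) yr by (auto simp: axis_def split: if_splits)
    with t(2) pR show False by blast
  qed
qed

section \<open>M-natural-convexity over the integers\<close>

text \<open>The exchange axiom of \<open>Mnat_convex\<close> over \<open>int\<close>, where a strict
  inequality leaves a gap of at least one.\<close>

definition int_Mnat :: "(int ^ 'n) set \<Rightarrow> bool" where
  "int_Mnat S \<longleftrightarrow> (\<forall>x\<in>S. \<forall>y\<in>S. \<forall>i. y $ i < x $ i \<longrightarrow>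
     (x - axis i 1 \<in> S \<and> y + axis i 1 \<in> S) \<or> exchangeable S x y i)"

lemma int_Mnat_uminus:
  assumes "int_Mnat S"
  shows "int_Mnat (uminus ` S)"
  unfolding int_Mnat_def
proof (intro ballI allI impI)
  fix x y i assume "x \<in> uminus ` S" "y \<in> uminus ` S" "y $ i < x $ i"
  then have "- y \<in> S" "- x \<in> S" "(- x) $ i < (- y) $ i"
    by (simp_all add: mem_uminus_image)
  with assms have "(- y - axis i 1 \<in> S \<and> - x + axis i 1 \<in> S) \<or> exchangeable S (- y) (- x) i"
    unfolding int_Mnat_def by blast
  then show "(x - axis i 1 \<in> uminus ` S \<and> y + axis i 1 \<in> uminus ` S) \<or>
      exchangeable (uminus ` S) x y i"
    by (auto simp: mem_uminus_image exchangeable_uminus algebra_simps)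
qed

lemma sum_axis: "(\<Sum>k\<in>UNIV. axis i (1::int) $ k) = 1"
  by (simp add: axis_def)

text \<open>If \<open>x\<close> cannot simply be lowered at \<open>k\<close>, the axiom gives
  \<open>x - axis k 1 + axis q 1\<close>, which is closer to \<open>y\<close> and has the same sum.
  By induction it can be lowered at some \<open>k'\<close>, and exchanges with \<open>x\<close> turn
  the result into a lowering of \<open>x\<close> itself.\<close>

lemma int_Mnat_decrease:
  assumes S: "int_Mnat S" and "x \<in> S" "y \<in> S" "(\<Sum>k\<in>UNIV. y $ k) < (\<Sum>k\<in>UNIV. x $ k)"
  shows "\<exists>k. y $ k < x $ k \<and> x - axis k 1 \<in> S"
  using assms(2-4)
proof (induction "dist1 x y" arbitrary: x rule: less_induct)
  case less
  obtain k where k: "y $ k < x $ k"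
    using less.prems(3) by (meson linorder_not_less sum_mono)
  show ?case
  proof (cases "x - axis k 1 \<in> S")
    case False
    with S less.prems k obtain q where q: "x $ q < y $ q" "x - axis k 1 + axis q 1 \<in> S"
      unfolding int_Mnat_def exchangeable_def by blast
    have kq: "k \<noteq> q" using k q by auto
    have "dist1 (x - axis k 1 + axis q 1) y < dist1 x y"
      using k q by (intro dist1_less[where i = k]) (auto simp: axis_def)
    moreover have "(\<Sum>l\<in>UNIV. y $ l) < (\<Sum>l\<in>UNIV. (x - axis k 1 + axis q 1) $ l)"
      using less.prems(3) by (simp add: sum.distrib sum_subtractf sum_axis)
    ultimately obtain k' where k': "y $ k' < (x - axis k 1 + axis q 1) $ k'"
      "x - axis k 1 + axis q 1 - axis k' 1 \<in> S"
      using less.hyps q(2) less.prems(2) by blast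
    have k'q: "k' \<noteq> q" using k' q kq by (auto simp: axis_def)
    have k'x: "y $ k' < x $ k'" using k' k'q by (auto simp: axis_def split: if_splits)
    define w where "w = x - axis k 1 + axis q 1 - axis k' 1"
    \<comment> \<open>As \<open>w\<close> exceeds \<open>x\<close> at \<open>q\<close>, an exchange
      there cancels the \<open>axis q 1\<close> in \<open>w\<close>.\<close>
    have "x $ q < w $ q" using kq k'q by (auto simp: w_def axis_def)
    then consider "w - axis q 1 \<in> S" | j where "w $ j < x $ j" "w - axis q 1 + axis j 1 \<in> S"
      using S less.prems(1) k'(2) unfolding int_Mnat_def exchangeable_def w_def by blast
    then show ?thesis
    proof cases
      case 1
      define v where "v = w - axis q 1"
      have vk: "v $ k < x $ k" by (auto simp: v_def w_def axis_def)
      \<comment> \<open>Since \<open>v\<close> is nowhere above \<open>x\<close>, the exchange of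
        \<open>x\<close> and \<open>v\<close> at \<open>k\<close> must be the one without a partner
        \<open>j\<close>.\<close>
      have "\<not> x $ j < v $ j" for j by (auto simp: v_def w_def axis_def)
      with S less.prems(1) 1 vk have "v + axis k 1 \<in> S"
        unfolding int_Mnat_def exchangeable_def v_def by blast
      then have "x - axis k' 1 \<in> S" by (simp add: v_def w_def)
      with k'x show ?thesis by blast
    next
      case 2
      then have "j = k \<or> j = k'" by (auto simp: w_def axis_def split: if_splits)
      then show ?thesis
      proof
        assume "j = k"
        with 2 have "x - axis k' 1 \<in> S" by (simp add: w_def)
        with k'x show ?thesis by blast
      next
        assume "j = k'"
        with 2 have "x - axis k 1 \<in> S" by (simp add: w_def)
        with k show ?thesis by blast
      qed
    qed
  qed (use k in blast)
qed

lemma int_Mnat_increase: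
  assumes S: "int_Mnat S" and "x \<in> S" "y \<in> S" "(\<Sum>k\<in>UNIV. x $ k) < (\<Sum>k\<in>UNIV. y $ k)"
  shows "\<exists>k. x $ k < y $ k \<and> x + axis k 1 \<in> S"
proof -
  have "\<exists>k. (- y) $ k < (- x) $ k \<and> - x - axis k 1 \<in> uminus ` S"
    using assms by (intro int_Mnat_decrease int_Mnat_uminus) (auto simp: mem_uminus_image sum_negf)
  then show ?thesis by (auto simp: mem_uminus_image algebra_simps)
qed

section \<open>Homogenization by an additional coordinate\<close>

text \<open>The standard lift from M-natural-convex to M-convex sets: every image has component sum
  zero, and the coordinates \<open>Some i\<close> recover the vector.\<close>

definition homogenize :: "int ^ 'n \<Rightarrow> int ^ ('n option)" where
  "homogenize x = (\<chi> k. case k of None \<Rightarrow> - (\<Sum>i\<in>UNIV. x $ i) | Some i \<Rightarrow> x $ i)"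

lemma homogenize_nth [simp]:
  "homogenize x $ Some i = x $ i" "homogenize x $ None = - (\<Sum>i\<in>UNIV. x $ i)"
  by (simp_all add: homogenize_def)

lemma homogenize_add: "homogenize (x + y) = homogenize x + homogenize y"
  by (simp add: vec_eq_iff homogenize_def sum.distrib split: option.split)

lemma homogenize_uminus: "homogenize (- x) = - homogenize x"
  by (simp add: vec_eq_iff homogenize_def sum_negf split: option.split)

lemma homogenize_diff: "homogenize (x - y) = homogenize x - homogenize y"
  using homogenize_add[of x "- y"] by (simp add: homogenize_uminus)

text \<open>A change of a single coordinate thus becomes an exchange with \<open>None\<close>, which
  unifies the two alternatives of the axiom.\<close>

lemma homogenize_axis: "homogenize (axis i 1) = axis (Some i) 1 - axis None 1"
  by (auto simp: vec_eq_iff homogenize_def sum_axis axis_def split: option.split)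

text \<open>Lowering \<open>None\<close> means raising \<open>x\<close>, possible because its sum is
  the smaller one. Lowering \<open>Some i\<close> either has a partner already or leads to
  \<open>x - axis i 1\<close>: the partner is \<open>None\<close> if the sum of \<open>x\<close> is
  the larger one, and otherwise a further increase supplies it.\<close>

lemma one_sided_exchange_homogenize:
  assumes S: "int_Mnat S"
  shows "one_sided_exchange (homogenize ` S)"
  unfolding one_sided_exchange_def
proof (intro ballI allI impI)
  fix X Y s assume "X \<in> homogenize ` S" "Y \<in> homogenize ` S" and s: "Y $ s < X $ s"
  then obtain x y where x: "x \<in> S" "X = homogenize x" and y: "y \<in> S" "Y = homogenize y" by auto
  let ?G = "\<lambda>j. X $ j < Y $ j \<and> X - axis s 1 + axis j 1 \<in> homogenize ` S"
  show "\<exists>j. ?G j"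
  proof (cases s)
    case None
    then obtain k where "x $ k < y $ k" "x + axis k 1 \<in> S"
      using int_Mnat_increase[OF S x(1) y(1)] s x y by auto
    then have "?G (Some k)"
      using x y None homogenize_add[of x "axis k 1"]
      by (auto simp: homogenize_axis algebra_simps intro!: image_eqI[where x = "x + axis k 1"])
    then show ?thesis ..
  next
    case (Some i)
    have swap: "?G (Some j)" if "x $ j < y $ j" "x - axis i 1 + axis j 1 \<in> S" for j
      using that x y Some
      by (auto simp: homogenize_axis homogenize_add homogenize_diff algebra_simps
          intro!: image_eqI[where x = "x - axis i 1 + axis j 1"])
    have i: "y $ i < x $ i" using s x y Some by simp
    then consider "x - axis i 1 \<in> S" | j where "x $ j < y $ j" "x - axis i 1 + axis j 1 \<in> S"
      using S x y unfolding int_Mnat_def exchangeable_def by blast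
    then show ?thesis
    proof cases
      case 1
      show ?thesis
      proof (cases "(\<Sum>k\<in>UNIV. y $ k) < (\<Sum>k\<in>UNIV. x $ k)")
        case True
        then have "?G None"
          using 1 x y Some
          by (auto simp: homogenize_axis homogenize_diff algebra_simps
              intro!: image_eqI[where x = "x - axis i 1"])
        then show ?thesis ..
      next
        case False
        then have "(\<Sum>k\<in>UNIV. (x - axis i 1) $ k) < (\<Sum>k\<in>UNIV. y $ k)"
          by (simp add: sum_subtractf sum_axis)
        then obtain k where k: "(x - axis i 1) $ k < y $ k" "x - axis i 1 + axis k 1 \<in> S"
          using int_Mnat_increase[OF S 1 y(1)] by blast
        \<comment> \<open>Here \<open>k = i\<close> would give
          \<open>x $ i \<le> y $ i\<close>.\<close>
        then have "x $ k < y $ k" using i by (auto simp: axis_def split: if_splits)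
        with swap k(2) show ?thesis by blast
      qed
    next
      case 2
      then show ?thesis using swap by blast
    qed
  qed
qed

lemma one_sided_exchange_homogenize_uminus:
  assumes "int_Mnat S"
  shows "one_sided_exchange (uminus ` homogenize ` S)"
proof -
  have "uminus ` homogenize ` S = homogenize ` uminus ` S"
    by (simp add: image_image homogenize_uminus)
  with assms show ?thesis by (simp add: one_sided_exchange_homogenize int_Mnat_uminus)
qed

section \<open>Convex combinations of close integer points\<close>

definition of_int_vec :: "int ^ 'n \<Rightarrow> real ^ 'n" where
  "of_int_vec z = (\<chi> i. of_int (z $ i))"

lemma of_int_vec_nth [simp]: "of_int_vec z $ i = of_int (z $ i)"
  by (simp add: of_int_vec_def)

lemma of_int_vec_add: "of_int_vec (x + y) = of_int_vec x + of_int_vec y"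
  by (simp add: vec_eq_iff)

lemma of_int_vec_eq_iff [simp]: "of_int_vec x = of_int_vec y \<longleftrightarrow> x = y"
  by (simp add: vec_eq_iff)

lemma finite_int_box: "finite {z :: int ^ 'n. \<forall>i. \<bar>z $ i\<bar> \<le> M}"
proof (rule finite_imageD)
  show "finite (vec_nth ` {z :: int ^ 'n. \<forall>i. \<bar>z $ i\<bar> \<le> M})"
    by (rule finite_subset[of _ "\<Pi>\<^sub>E i\<in>UNIV. {- M..M}"]) (auto simp: finite_PiE abs_le_iff minus_le_iff)
qed (simp add: inj_on_def vec_nth_inject)

lemma convex_hull_shift_weight:
  fixes p :: "'a::real_vector"
  assumes G: "finite G" "\<And>s. s \<in> G \<Longrightarrow> 0 \<le> u s" "sum u G = 1" "(\<Sum>s\<in>G. u s *\<^sub>R s) = p"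
    and ab: "a \<in> G" "b \<in> G" "a \<noteq> b" "a' \<in> G" "b' \<in> G"
    and d: "0 \<le> d" "d \<le> u a" "d \<le> u b"
  shows "p + d *\<^sub>R (a' + b' - a - b) \<in> convex hull G"
proof -
  \<comment> \<open>The additive form covers coincidences of \<open>a'\<close> and \<open>b'\<close>
    with each other or with \<open>a\<close> and \<open>b\<close>. As \<open>a \<noteq> b\<close>,
    no point loses more than \<open>d\<close>.\<close>
  define v where "v s = u s + (if s = a' then d else 0) + (if s = b' then d else 0)
    - (if s = a then d else 0) - (if s = b then d else 0)" for s
  have *: "(if P then d else 0) *\<^sub>R s = (if P then d *\<^sub>R s else 0)" for P and s :: 'a by simp
  have "sum v G = 1"
    using G ab by (simp add: v_def sum.distrib sum_subtractf)
  moreover have "(\<Sum>s\<in>G. v s *\<^sub>R s) = p + d *\<^sub>R (a' + b' - a - b)"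
    using G ab
    by (simp add: v_def sum.distrib sum_subtractf scaleR_add_left scaleR_diff_left * algebra_simps)
  moreover have "0 \<le> v s" if "s \<in> G" for s
    using G(2)[OF that] ab d by (auto simp: v_def)
  ultimately show ?thesis
    unfolding convex_hull_finite[OF G(1)] by blast
qed

text \<open>Among the representations of \<open>X\<close> by points of a finite box, one minimizing the mean of
  the squared Euclidean norm has the required support: an exchange between two points that differ
  by at least 2 in some coordinate preserves the barycentre and lowers this mean.\<close>

lemma convex_hull_near_support:
  fixes X :: "real ^ 'm"
  assumes T: "\<And>x y i. x \<in> T \<Longrightarrow> y \<in> T \<Longrightarrow> y $ i < x $ i \<Longrightarrow> exchangeable T x y i"
    and X: "X \<in> convex hull (of_int_vec ` T)"
  obtains F u where "finite F" "F \<subseteq> T" "\<And>a. a \<in> F \<Longrightarrow> 0 < u a" "sum u F = (1::real)"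
    "(\<Sum>a\<in>F. u a *\<^sub>R of_int_vec a) = X" "\<And>a b i. a \<in> F \<Longrightarrow> b \<in> F \<Longrightarrow> a $ i \<le> b $ i + 1"
proof -
  obtain R where R: "finite R" "R \<subseteq> of_int_vec ` T" "X \<in> convex hull R"
  proof -
    obtain R u where "finite R" "R \<subseteq> of_int_vec ` T" "\<forall>s\<in>R. 0 \<le> u s" "sum u R = 1"
      "(\<Sum>s\<in>R. u s *\<^sub>R s) = X"
      using X unfolding convex_hull_explicit by blast
    then show thesis using that[of R] by (auto simp: convex_hull_finite)
  qed
  then obtain F0 where F0: "finite F0" "F0 \<subseteq> T" "R = of_int_vec ` F0"
    by (meson finite_subset_image)
  define M where "M = (\<Sum>z\<in>F0. \<Sum>i\<in>UNIV. \<bar>z $ i\<bar>)"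
  have M: "\<bar>z $ i\<bar> \<le> M" if "z \<in> F0" for z i
  proof -
    have "\<bar>z $ i\<bar> \<le> (\<Sum>i\<in>UNIV. \<bar>z $ i\<bar>)" by (rule member_le_sum) auto
    also have "\<dots> \<le> M" unfolding M_def using that F0 by (intro member_le_sum) (auto intro: sum_nonneg)
    finally show ?thesis .
  qed
  define B where "B = {z \<in> T. \<forall>i. \<bar>z $ i\<bar> \<le> M}"
  have finB: "finite B"
    by (rule finite_subset[OF _ finite_int_box[of M]]) (auto simp: B_def)
  define Q where "Q z = (\<Sum>i\<in>UNIV. (z $ i)\<^sup>2)" for z :: "int ^ 'm"
  \<comment> \<open>Lifting to the graph of the squared norm: a point over \<open>X\<close> in the
    hull of the lifted points records a representation of \<open>X\<close> with its mean of
    \<open>Q\<close>. These points form a compact set, so a minimum is attained.\<close>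
  define L where "L z = (of_int_vec z, real_of_int (Q z))" for z :: "int ^ 'm"
  have injL: "inj_on L B" by (auto simp: L_def inj_on_def)
  have finLB: "finite (L ` B)" using finB by simp
  let ?K = "convex hull (L ` B) \<inter> {p. fst p = X}"
  have compK: "compact ?K"
    by (intro compact_Int_closed finite_imp_compact_convex_hull finLB closed_Collect_eq
        continuous_intros)
  have neK: "?K \<noteq> {}"
  proof -
    have "F0 \<subseteq> B" using F0 M by (auto simp: B_def)
    then have "R \<subseteq> fst ` L ` B" using F0 by (auto simp: L_def image_image)
    then have "X \<in> convex hull (fst ` L ` B)" using R(3) hull_mono by blast
    then have "X \<in> fst ` (convex hull (L ` B))"
      by (simp add: convex_hull_linear_image linear_fst)
    then show ?thesis by auto
  qed
  have contK: "continuous_on ?K snd" by (intro continuous_intros)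
  obtain p where p: "p \<in> ?K" and min: "\<And>q. q \<in> ?K \<Longrightarrow> snd p \<le> snd q"
    using continuous_attains_inf[OF compK neK contK] by blast
  then have "p \<in> convex hull (L ` B)" by blast
  then obtain w where w: "\<And>s. s \<in> L ` B \<Longrightarrow> 0 \<le> w s" "sum w (L ` B) = 1"
    "(\<Sum>s\<in>L ` B. w s *\<^sub>R s) = p"
    unfolding convex_hull_finite[OF finLB] by blast
  have diff: "a $ i \<le> b $ i + 1" if ab: "a \<in> B" "b \<in> B" and pos: "0 < w (L a)" "0 < w (L b)" for a b i
  proof (rule ccontr)
    assume far: "\<not> a $ i \<le> b $ i + 1"
    have "a \<in> T" "b \<in> T" using ab by (simp_all add: B_def)
    then have "exchangeable T a b i" using far by (intro T) simp_all
    then obtain j where j: "a $ j < b $ j" "a - axis i 1 + axis j 1 \<in> T" "b + axis i 1 - axis j 1 \<in> T"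
      unfolding exchangeable_def by blast
    define a' where "a' = a - axis i 1 + axis j 1"
    define b' where "b' = b + axis i 1 - axis j 1"
    have ij: "i \<noteq> j" using j far by auto
    have nth: "a' $ k = a $ k - (if k = i then 1 else 0) + (if k = j then 1 else 0)"
      "b' $ k = b $ k + (if k = i then 1 else 0) - (if k = j then 1 else 0)" for k
      by (auto simp: a'_def b'_def axis_def)
    have bnd: "\<bar>a $ k\<bar> \<le> M" "\<bar>b $ k\<bar> \<le> M" for k using ab by (auto simp: B_def)
    \<comment> \<open>The exchange stays in the box because each new coordinate lies between the old
      ones.\<close>
    have "\<bar>a' $ k\<bar> \<le> M" "\<bar>b' $ k\<bar> \<le> M" for k
      using bnd[of k] far j(1) ij by (auto simp: nth)
    then have mem: "a' \<in> B" "b' \<in> B"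
      using j by (auto simp: B_def a'_def b'_def)
    have "Q a' + Q b' < Q a + Q b"
      unfolding Q_def sum.distrib[symmetric]
    proof (rule sum_strict_mono_ex1)
      \<comment> \<open>The change is strictly negative at \<open>i\<close>, where the gap is at
        least 2, and at most zero at \<open>j\<close>, where the gap is at least 1.\<close>
      have sq: "(a' $ k)\<^sup>2 + (b' $ k)\<^sup>2 = (a $ k)\<^sup>2 + (b $ k)\<^sup>2 +
          (if k = i then 2 * (b $ i - a $ i + 1) else if k = j then 2 * (a $ j - b $ j + 1) else 0)" for k
        using ij by (simp add: nth power2_eq_square algebra_simps)
      show "\<forall>k\<in>UNIV. (a' $ k)\<^sup>2 + (b' $ k)\<^sup>2 \<le> (a $ k)\<^sup>2 + (b $ k)\<^sup>2"
        using far j(1) by (simp add: sq)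
      show "\<exists>k\<in>UNIV. (a' $ k)\<^sup>2 + (b' $ k)\<^sup>2 < (a $ k)\<^sup>2 + (b $ k)\<^sup>2"
        using far by (intro bexI[of _ i]) (simp_all add: sq)
    qed simp
    then have Qless: "real_of_int (Q a') + real_of_int (Q b') < real_of_int (Q a) + real_of_int (Q b)"
      by linarith
    have "a \<noteq> b" using far by auto
    then have ne: "L a \<noteq> L b" by (simp add: L_def)
    \<comment> \<open>The largest weight that can be taken from both points.\<close>
    define d where "d = min (w (L a)) (w (L b))"
    have d: "0 < d" using pos by (simp add: d_def)
    define q where "q = p + d *\<^sub>R (L a' + L b' - L a - L b)"
    have "q \<in> convex hull (L ` B)"
      unfolding q_def
      by (rule convex_hull_shift_weight[OF finLB w]) (use ab mem ne d in \<open>auto simp: d_def\<close>)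
    moreover have "of_int_vec a' + of_int_vec b' = of_int_vec a + of_int_vec b"
      by (simp add: of_int_vec_add[symmetric] a'_def b'_def)
    then have "fst (L a' + L b' - L a - L b) = 0"
      by (simp add: L_def)
    then have "fst q = X" using p by (simp add: q_def)
    ultimately have "snd p \<le> snd q" using min by simp
    moreover have "snd q = snd p + d * (real_of_int (Q a') + real_of_int (Q b') - real_of_int (Q a) - real_of_int (Q b))"
      by (simp add: q_def L_def)
    ultimately show False
      using mult_pos_neg[OF d, of "real_of_int (Q a') + real_of_int (Q b') - real_of_int (Q a) - real_of_int (Q b)"]
        Qless by linarith
  qed
  define F where "F = {a \<in> B. 0 < w (L a)}"
  have FB: "F \<subseteq> B" by (auto simp: F_def)
  have w0: "\<forall>a\<in>B - F. w (L a) = 0"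
  proof
    fix a assume "a \<in> B - F"
    with w(1)[of "L a"] show "w (L a) = 0" by (simp add: F_def)
  qed
  show thesis
  proof (rule that[of F "\<lambda>a. w (L a)"])
    show "finite F" using finB FB by (rule rev_finite_subset)
    have "sum (\<lambda>a. w (L a)) F = sum (\<lambda>a. w (L a)) B"
      using FB w0 finB by (intro sum.mono_neutral_left) auto
    then show "sum (\<lambda>a. w (L a)) F = 1"
      using w(2) injL by (simp add: sum.reindex)
    have "(\<Sum>a\<in>F. w (L a) *\<^sub>R of_int_vec a) = (\<Sum>a\<in>B. w (L a) *\<^sub>R of_int_vec a)"
      using FB w0 finB by (intro sum.mono_neutral_left) auto
    also have "\<dots> = fst (\<Sum>s\<in>L ` B. w s *\<^sub>R s)"
      by (simp add: fst_sum sum.reindex[OF injL]) (simp add: L_def)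
    finally show "(\<Sum>a\<in>F. w (L a) *\<^sub>R of_int_vec a) = X"
      using w(3) p by simp
  qed (use diff in \<open>auto simp: F_def B_def\<close>)
qed

section \<open>Rounding by a random point\<close>

text \<open>On \<open>F\<close> the function takes at most two values, \<open>c\<close> and
  \<open>c + 1\<close>, whose distances from the mean are \<open>th\<close> and
  \<open>1 - th\<close>. As \<open>t \<le> 1/2\<close>, at most one of them exceeds
  \<open>1 - t\<close>: the value \<open>c + 1\<close> if \<open>th < t\<close>, which has weight
  \<open>th\<close>, or \<open>c\<close> if \<open>1 - th < t\<close>, which has weight
  \<open>1 - th\<close>.\<close>

lemma expected_violation_less:
  fixes u :: "'a \<Rightarrow> real" and f :: "'a \<Rightarrow> int"
  assumes F: "finite F" "\<And>a. a \<in> F \<Longrightarrow> 0 < u a" "sum u F = 1"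
    and f: "\<And>a b. a \<in> F \<Longrightarrow> b \<in> F \<Longrightarrow> f a \<le> f b + 1"
    and t: "0 < t" "t \<le> 1/2"
  shows "(\<Sum>a\<in>F. u a * of_bool (\<bar>(\<Sum>b\<in>F. u b * of_int (f b)) - of_int (f a)\<bar> > 1 - t)) < t"
proof -
  have ne: "F \<noteq> {}" using F by auto
  define c where "c = Min (f ` F)"
  have "c \<in> f ` F" unfolding c_def using F ne by (intro Min_in) auto
  then have up: "f a \<le> c + 1" if "a \<in> F" for a using f that by auto
  have lo: "c \<le> f a" if "a \<in> F" for a unfolding c_def using F that by (intro Min_le) auto
  have cs: "f a = c \<or> f a = c + 1" if "a \<in> F" for a using up[OF that] lo[OF that] by linarith
  define s where "s = (\<Sum>b\<in>F. u b * of_int (f b))"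
  \<comment> \<open>The fractional offset of the mean, equal to the total weight of the points with
    value \<open>c + 1\<close>.\<close>
  define th where "th = s - of_int c"
  have th: "(\<Sum>a\<in>F. u a * of_int (f a - c)) = th"
    using F(3) by (simp add: th_def s_def algebra_simps sum_subtractf sum_distrib_left[symmetric])
  have th': "(\<Sum>a\<in>F. u a * (1 - of_int (f a - c))) = 1 - th"
    using F(3) th by (simp add: algebra_simps sum_subtractf sum.distrib)
  have "0 \<le> th" unfolding th[symmetric] using F(2) lo by (intro sum_nonneg mult_nonneg_nonneg) (auto simp: less_imp_le)
  moreover have "0 \<le> 1 - th" unfolding th'[symmetric] using F(2) cs
    by (intro sum_nonneg mult_nonneg_nonneg) (force simp: less_imp_le)+
  ultimately have th01: "0 \<le> th" "th \<le> 1" by auto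
  let ?v = "\<lambda>a. of_bool (\<bar>s - of_int (f a)\<bar> > 1 - t) :: real"
  have v: "\<bar>s - of_int (f a)\<bar> = (if f a = c then th else 1 - th)" if "a \<in> F" for a
    using cs[OF that] th01 by (auto simp: th_def)
  consider "th < t" | "th > 1 - t" | "t \<le> th" "th \<le> 1 - t" by linarith
  then have "(\<Sum>a\<in>F. u a * ?v a) < t"
  proof cases
    case 1
    have "(\<Sum>a\<in>F. u a * ?v a) \<le> (\<Sum>a\<in>F. u a * of_int (f a - c))"
    proof (intro sum_mono mult_left_mono)
      fix a assume "a \<in> F"
      then show "?v a \<le> of_int (f a - c)" using v[of a] cs[of a] 1 t by auto
    qed (use F(2) in \<open>auto simp: less_imp_le\<close>)
    with th 1 show ?thesis by simp
  next
    case 2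
    have "(\<Sum>a\<in>F. u a * ?v a) \<le> (\<Sum>a\<in>F. u a * (1 - of_int (f a - c)))"
    proof (intro sum_mono mult_left_mono)
      fix a assume "a \<in> F"
      then show "?v a \<le> 1 - of_int (f a - c)" using v[of a] cs[of a] 2 t by auto
    qed (use F(2) in \<open>auto simp: less_imp_le\<close>)
    with th' 2 show ?thesis by simp
  next
    case 3
    have "(\<Sum>a\<in>F. u a * ?v a) = 0"
      using v 3 by (intro sum.neutral) auto
    with t show ?thesis by simp
  qed
  then show ?thesis by (simp add: s_def)
qed

text \<open>A union bound with \<open>t = 1 / card I\<close>: the expected number of violated
  coordinates in \<open>I\<close> is less than 1. The set \<open>I\<close> makes it possible to
  leave out the additional coordinate.\<close>

lemma exists_near_point:
  fixes X :: "real ^ 'm"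
  assumes T: "\<And>x y i. x \<in> T \<Longrightarrow> y \<in> T \<Longrightarrow> y $ i < x $ i \<Longrightarrow> exchangeable T x y i"
    and X: "X \<in> convex hull (of_int_vec ` T)"
    and I: "2 \<le> card I"
  obtains z where "z \<in> T" "\<And>i. i \<in> I \<Longrightarrow> \<bar>X $ i - of_int (z $ i)\<bar> \<le> 1 - 1 / real (card I)"
proof (rule convex_hull_near_support[OF T X])
  fix F u
  assume F: "finite F" "F \<subseteq> T" "\<And>a. a \<in> F \<Longrightarrow> 0 < u a" "sum u F = (1::real)"
    "(\<Sum>a\<in>F. u a *\<^sub>R of_int_vec a) = X" "\<And>a b i. a \<in> F \<Longrightarrow> b \<in> F \<Longrightarrow> a $ i \<le> b $ i + 1"
  let ?t = "1 / real (card I)"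
  have t: "0 < ?t" "?t \<le> 1/2" using I by (auto simp: field_simps)
  have fin: "finite I" "I \<noteq> {}" using I by (auto intro: card_ge_0_finite)
  let ?v = "\<lambda>a i. of_bool (\<bar>X $ i - of_int (a $ i)\<bar> > 1 - ?t) :: real"
  have "(\<Sum>a\<in>F. u a * ?v a i) < ?t" for i
  proof -
    have "X $ i = (\<Sum>b\<in>F. u b * of_int (b $ i))" by (simp flip: F(5))
    then show ?thesis
      using expected_violation_less[where f = "\<lambda>a. a $ i", OF F(1,3,4) F(6) t] by simp
  qed
  then have "(\<Sum>i\<in>I. \<Sum>a\<in>F. u a * ?v a i) < (\<Sum>i\<in>I. ?t)"
    using fin by (intro sum_strict_mono) auto
  also have "\<dots> = 1" using fin by simp
  also have "(\<Sum>i\<in>I. \<Sum>a\<in>F. u a * ?v a i) = (\<Sum>a\<in>F. u a * (\<Sum>i\<in>I. ?v a i))"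
    unfolding sum_distrib_left by (rule sum.swap)
  finally have less: "(\<Sum>a\<in>F. u a * (\<Sum>i\<in>I. ?v a i)) < (\<Sum>a\<in>F. u a * 1)"
    using F(4) by simp
  \<comment> \<open>A count of violations below 1 is zero, so such a point violates no coordinate in
    \<open>I\<close>.\<close>
  have "\<exists>a\<in>F. (\<Sum>i\<in>I. ?v a i) < 1"
  proof (rule ccontr)
    assume "\<not> ?thesis"
    then have "1 \<le> (\<Sum>i\<in>I. ?v a i)" if "a \<in> F" for a
      using that by (meson linorder_not_le)
    then have "(\<Sum>a\<in>F. u a * 1) \<le> (\<Sum>a\<in>F. u a * (\<Sum>i\<in>I. ?v a i))"
      using F(3) by (intro sum_mono mult_left_mono) (simp_all only: less_imp_le)
    with less show False by simp
  qed
  then obtain a where a: "a \<in> F" "(\<Sum>i\<in>I. ?v a i) < 1" by blast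
  show thesis
  proof (rule that[of a])
    fix i assume i: "i \<in> I"
    have "?v a i \<le> (\<Sum>i\<in>I. ?v a i)" using i fin by (intro member_le_sum) auto
    with a(2) have "?v a i < 1" by linarith
    then show "\<bar>X $ i - of_int (a $ i)\<bar> \<le> 1 - ?t" by (auto simp: of_bool_def split: if_splits)
  qed (use a F in auto)
qed

section \<open>Transfer from real to integer vectors and conclusion\<close>

lemma Mnat_convex_int:
  fixes S :: "(real ^ 'n) set"
  assumes "Mnat_convex S"
  shows "int_Mnat {z. of_int_vec z \<in> S}" and "S = of_int_vec ` {z. of_int_vec z \<in> S}"
proof -
  have ax: "of_int_vec (x - axis i 1) = of_int_vec x - axis i 1"
    "of_int_vec (x + axis i 1) = of_int_vec x + axis i 1" for x :: "int ^ 'n" and i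
    by (simp_all add: vec_eq_iff axis_def)
  show "int_Mnat {z. of_int_vec z \<in> S}"
    unfolding int_Mnat_def exchangeable_def
  proof (intro ballI allI impI, unfold mem_Collect_eq)
    fix x y :: "int ^ 'n" and i
    assume h: "of_int_vec x \<in> S" "of_int_vec y \<in> S" "y $ i < x $ i"
    from assms have "\<forall>x\<in>S. \<forall>y\<in>S. \<forall>i. x $ i > y $ i \<longrightarrow>
        (x - axis i 1 \<in> S \<and> y + axis i 1 \<in> S) \<or>
        (\<exists>j. x $ j < y $ j \<and> x - axis i 1 + axis j 1 \<in> S \<and> y + axis i 1 - axis j 1 \<in> S)"
      unfolding Mnat_convex_def by blast
    from this[rule_format, OF h(1,2), of i] h(3)
    show "of_int_vec (x - axis i 1) \<in> S \<and> of_int_vec (y + axis i 1) \<in> S \<or>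
      (\<exists>j. x $ j < y $ j \<and> of_int_vec (x - axis i 1 + axis j 1) \<in> S \<and>
        of_int_vec (y + axis i 1 - axis j 1) \<in> S)"
      by (simp add: ax)
  qed
  have "x \<in> of_int_vec ` {z. of_int_vec z \<in> S}" if "x \<in> S" for x
  proof -
    have "\<forall>i. x $ i \<in> \<int>" using assms that unfolding Mnat_convex_def by blast
    then have "of_int_vec (\<chi> i. \<lfloor>x $ i\<rfloor>) = x" by (simp add: vec_eq_iff of_int_floor)
    with that show ?thesis by (metis image_eqI mem_Collect_eq)
  qed
  then show "S = of_int_vec ` {z. of_int_vec z \<in> S}" by auto
qed

theorem theorem3p5:
  fixes S :: "nat \<Rightarrow> (real ^ 'n) set" and m :: nat and W :: "(real ^ 'n) set"
  assumes "CARD('n) \<ge> 2" and "m \<ge> 1"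
    and "\<And>k. k \<in> {1..m} \<Longrightarrow> Mnat_convex (S k)"
    and "W = (\<Sum>k\<in>{1..m}. S k)"
  shows "\<forall>x \<in> convex hull W. \<exists>z \<in> W. infnorm (x - z) \<le> 1 - 1 / real CARD('n)"
proof
  fix x assume x: "x \<in> convex hull W"
  define H where "H k = homogenize ` {z. of_int_vec z \<in> S k}" for k
  define T where "T = (\<Sum>k\<in>{1..m}. H k)"
  define \<pi> :: "real ^ ('n option) \<Rightarrow> real ^ 'n" where "\<pi> v = (\<chi> i. v $ Some i)" for v
  have lin: "linear \<pi>" by (auto simp: \<pi>_def linear_iff vec_eq_iff)
  have \<pi>: "\<pi> (of_int_vec (homogenize z)) = of_int_vec z" for z
    by (simp add: \<pi>_def vec_eq_iff)
  \<comment> \<open>Negation distributes over the sum, so the dual exchange property also passes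
    from the summands to \<open>T\<close>.\<close>
  have "uminus ` T = (\<Sum>k\<in>{1..m}. uminus ` H k)"
    unfolding T_def by (intro additive_image_sum_sets) auto
  moreover have "int_Mnat {z. of_int_vec z \<in> S k}" if "k \<in> {1..m}" for k
    using Mnat_convex_int(1) assms(3) that by blast
  ultimately have "one_sided_exchange T" "one_sided_exchange (uminus ` T)"
    by (auto simp: T_def H_def intro!: one_sided_exchange_sum one_sided_exchange_homogenize
        one_sided_exchange_homogenize_uminus)
  then have T: "exchangeable T a b i" if "a \<in> T" "b \<in> T" "b $ i < a $ i" for a b i
    using one_sided_imp_exchangeable that by blast
  have "(\<lambda>t. \<pi> (of_int_vec t)) ` T = (\<Sum>k\<in>{1..m}. (\<lambda>t. \<pi> (of_int_vec t)) ` H k)"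
    unfolding T_def
    by (intro additive_image_sum_sets) (auto simp: of_int_vec_add \<pi>_def vec_eq_iff)
  also have "\<dots> = W"
    unfolding assms(4) using Mnat_convex_int(2) assms(3)
    by (intro sum.cong) (auto simp: H_def image_image \<pi>)
  finally have W: "W = \<pi> ` of_int_vec ` T" by (simp add: image_image)
  \<comment> \<open>A linear map commutes with convex hulls, so \<open>x\<close> lifts to a point
    over the homogenized sum.\<close>
  with x obtain X where X: "X \<in> convex hull (of_int_vec ` T)" "x = \<pi> X"
    using convex_hull_linear_image[OF lin, of "of_int_vec ` T"] by auto
  \<comment> \<open>Only the original coordinates are counted, which gives \<open>1 - 1/n\<close>
    although the lifted space has dimension \<open>n + 1\<close>.\<close>
  have card: "card (range (Some :: 'n \<Rightarrow> _)) = CARD('n)" by (simp add: card_image)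
  obtain z where z: "z \<in> T"
    "\<And>i. i \<in> range (Some :: 'n \<Rightarrow> _) \<Longrightarrow> \<bar>X $ i - of_int (z $ i)\<bar> \<le> 1 - 1 / real CARD('n)"
    using exists_near_point[OF T X(1), of "range Some"] assms(1) unfolding card by metis
  have "infnorm (x - \<pi> (of_int_vec z)) \<le> 1 - 1 / real CARD('n)"
    unfolding infnorm_cart using z(2) X(2) by (intro cSup_least) (auto simp: \<pi>_def)
  moreover have "\<pi> (of_int_vec z) \<in> W" using z(1) W by blast
  ultimately show "\<exists>z\<in>W. infnorm (x - z) \<le> 1 - 1 / real CARD('n)" by blast
qed

end
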